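(* Let $\sigma\in S_k$ be a fixed classical pattern and let $\sigma'\in S_k$ be chosen uniformly at random. Then the inequality $$a_\sigma(2k-1)>\binom{2k-1}{k}^2$$ is equivalent to the inequality $$a_\sigma(2k-1)>\mathbb E\big(a_{\sigma,\sigma'}(2k-1)\big).$$
   Context: $S_k$ is the set of permutations of $\{1,\dots,k\}$ in one-line notation. For a sequence $q$ of $k$ distinct numbers, $\operatorname{red}(q)\in S_k$ is the permutation whose entries are in the same relative order as those of $q$. For a permutation $\pi$, $\operatorname{subs}(\pi)$ is the set of subsequences of $\pi$; for two subsequences $x,y$ of $\pi$, $|x\cap y|$ is the number of entries of $\pi$ belonging to both. For $\sigma,\sigma'\in S_k$, $$A_{\sigma,\sigma'}(r)=\{(\pi,x,y): \pi\in S_r,\ x,y\in\operatorname{subs}(\pi),\ \operatorname{red}(x)=\sigma,\ \operatorname{red}(y)=\sigma',\ |x\cap y|=2k-r\},$$ $a_{\sigma,\sigma'}(r)=|A_{\sigma,\sigma'}(r)|$, and $a_\sigma(r)=a_{\sigma,\sigma}(r)$. *)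

theory Defs
  imports "HOL-Combinatorics.Multiset_Permutations" "HOL-Library.Sublist"
    "HOL-Probability.Probability_Mass_Function"
begin

text \<open>Permutations in one-line notation are lists of natural numbers with entries 1, ..., k.\<close>

definition Sym :: "nat \<Rightarrow> nat list set" where
  "Sym k = permutations_of_set {1..k}"

text \<open>Each entry is replaced by its rank among the entries. For distinct entries this is the
  unique permutation with the same relative order, see \<open>red_in_Sym\<close>, \<open>red_same_order\<close> and
  \<open>red_unique\<close> below.\<close>

definition red :: "nat list \<Rightarrow> nat list" where
  "red q = map (\<lambda>v. card {w \<in> set q. w \<le> v}) q"

definition subs :: "nat list \<Rightarrow> nat list set" where
  "subs \<pi> = {x. subseq x \<pi>}"

text \<open>As the entries of \<open>\<pi>\<close> are distinct, a subsequence is determined by its set of entries, and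
  \<open>set x \<inter> set y\<close> is the set of entries of \<open>\<pi>\<close> common to both subsequences. The size of the overlap is
  compared over the integers, so that there are no such triples when \<open>r > 2k\<close>.\<close>

definition A_set :: "nat \<Rightarrow> nat list \<Rightarrow> nat list \<Rightarrow> nat \<Rightarrow> (nat list \<times> nat list \<times> nat list) set" where
  "A_set k \<sigma> \<sigma>' r = {(\<pi>, x, y). \<pi> \<in> Sym r \<and> x \<in> subs \<pi> \<and> y \<in> subs \<pi> \<and>
     red x = \<sigma> \<and> red y = \<sigma>' \<and> int (card (set x \<inter> set y)) = 2 * int k - int r}"

definition a_pair :: "nat \<Rightarrow> nat list \<Rightarrow> nat list \<Rightarrow> nat \<Rightarrow> nat" where
  "a_pair k \<sigma> \<sigma>' r = card (A_set k \<sigma> \<sigma>' r)"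

definition a_self :: "nat \<Rightarrow> nat list \<Rightarrow> nat \<Rightarrow> nat" where
  "a_self k \<sigma> r = a_pair k \<sigma> \<sigma> r"

lemma rank_less_iff:
  fixes v w :: nat
  assumes "finite A" "v \<in> A" "w \<in> A"
  shows "card {u \<in> A. u \<le> v} < card {u \<in> A. u \<le> w} \<longleftrightarrow> v < w"
proof
  assume "v < w"
  then have "{u \<in> A. u \<le> v} \<subseteq> {u \<in> A. u \<le> w}" by auto
  moreover have "w \<in> {u \<in> A. u \<le> w} - {u \<in> A. u \<le> v}" using assms \<open>v < w\<close> by simp
  ultimately have "{u \<in> A. u \<le> v} \<subset> {u \<in> A. u \<le> w}" by blast
  then show "card {u \<in> A. u \<le> v} < card {u \<in> A. u \<le> w}"
    using assms by (intro psubset_card_mono) auto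
next
  assume less: "card {u \<in> A. u \<le> v} < card {u \<in> A. u \<le> w}"
  show "v < w"
  proof (rule ccontr)
    assume "\<not> v < w"
    then have "card {u \<in> A. u \<le> w} \<le> card {u \<in> A. u \<le> v}"
      using assms by (intro card_mono) auto
    with less show False by simp
  qed
qed

lemma red_same_order:
  assumes "i < length q" "j < length q"
  shows "red q ! i < red q ! j \<longleftrightarrow> q ! i < q ! j"
  using assms by (simp add: red_def rank_less_iff)

lemma red_in_Sym:
  assumes "distinct q"
  shows "red q \<in> Sym (length q)"
proof -
  let ?f = "\<lambda>v. card {w \<in> set q. w \<le> v}"
  have inj: "inj_on ?f (set q)"
  proof (rule inj_onI)
    fix v w assume vw: "v \<in> set q" "w \<in> set q" "?f v = ?f w"
    with rank_less_iff[of "set q" v w] rank_less_iff[of "set q" w v] show "v = w" by simp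
  qed
  have "?f ` set q \<subseteq> {1..length q}"
  proof
    fix z assume "z \<in> ?f ` set q"
    then obtain v where v: "v \<in> set q" "z = ?f v" by auto
    have "?f v \<le> card (set q)" by (intro card_mono) auto
    moreover have "?f v > 0" using v by (subst card_gt_0_iff) auto
    ultimately show "z \<in> {1..length q}"
      using v card_length[of q] by auto
  qed
  moreover have "card (?f ` set q) = length q"
    using inj assms by (simp add: card_image distinct_card)
  ultimately have "?f ` set q = {1..length q}"
    by (intro card_subset_eq) auto
  then show ?thesis
    using assms inj by (simp add: Sym_def permutations_of_set_def red_def distinct_map)
qed

lemma red_unique:
  assumes "p \<in> Sym (length q)"
    and "\<And>i j. i < length q \<Longrightarrow> j < length q \<Longrightarrow> p ! i < p ! j \<longleftrightarrow> q ! i < q ! j"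
  shows "red q = p"
proof -
  have p: "set p = {1..length q}" "distinct p"
    using assms(1) by (auto simp: Sym_def permutations_of_set_def)
  then have len: "length p = length q" using distinct_card[of p] by simp
  show ?thesis
  proof (rule nth_equalityI)
    show "length (red q) = length p" by (simp add: red_def len)
    fix i assume "i < length (red q)"
    then have i: "i < length q" by (simp add: red_def)
    have dq: "distinct q"
      unfolding distinct_conv_nth
    proof (intro allI impI)
      fix a b assume ab: "a < length q" "b < length q" "a \<noteq> b"
      then have "p ! a \<noteq> p ! b" using p len by (simp add: nth_eq_iff_index_eq)
      then show "q ! a \<noteq> q ! b" using assms(2)[of a b] assms(2)[of b a] ab by linarith
    qed
    let ?J = "{j. j < length q \<and> q ! j \<le> q ! i}"
    have J: "?J = {j. j < length q \<and> p ! j \<le> p ! i}"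
      using assms(2)[OF i] by (auto simp: not_less[symmetric])
    have "{w \<in> set q. w \<le> q ! i} = (!) q ` ?J"
      by (auto simp: in_set_conv_nth)
    moreover have "inj_on ((!) q) ?J"
      using dq by (auto simp: inj_on_def nth_eq_iff_index_eq)
    ultimately have "red q ! i = card ?J"
      using i by (simp add: red_def card_image)
    moreover have "{w \<in> set p. w \<le> p ! i} = (!) p ` ?J"
      unfolding J using len by (auto simp: in_set_conv_nth)
    moreover have "inj_on ((!) p) ?J"
      using p len by (auto simp: inj_on_def nth_eq_iff_index_eq)
    ultimately have "red q ! i = card {w \<in> set p. w \<le> p ! i}"
      by (simp add: card_image)
    also have "p ! i \<in> set p" using i len by simp
    then have "{w \<in> set p. w \<le> p ! i} = {1..p ! i}" using p by auto
    finally show "red q ! i = p ! i" by simp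
  qed
qed

end

theory Submission
  imports Defs
begin

text \<open>
  The expectation on the right-hand side equals the squared binomial coefficient on the left-hand
  side, so the two inequalities compare \<open>a_self k \<sigma> (2 * k - 1)\<close> with the same number.

  Averaging over \<open>\<sigma>'\<close> leaves of the condition on \<open>red y\<close> only its length: the sum of \<open>a_pair k \<sigma> \<sigma>' r\<close> over
  all \<open>\<sigma>'\<close> counts the triples in which \<open>y\<close> is any subsequence of length \<open>k\<close> with the prescribed
  overlap. These triples are built in three independent steps, each with a number of choices that
  depends only on \<open>k\<close> and \<open>r\<close>. A word \<open>x\<close> that reduces to \<open>\<sigma>\<close> is determined by its set of
  entries, which leaves \<open>r choose k\<close> words (\<open>card_words_with_red\<close>). A permutation that contains \<open>x\<close>
  as a subsequence is a shuffle of \<open>x\<close> with an arrangement of the \<open>r - k\<close> missing values, which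
  leaves \<open>(r choose k) * fact (r - k)\<close> permutations (\<open>card_permutations_containing_subseq\<close>). Finally,
  an overlap of \<open>2 * k - r\<close> forces \<open>y\<close> to use every entry outside \<open>x\<close>, so that \<open>y\<close> is determined by
  the \<open>2 * k - r\<close> entries it shares with \<open>x\<close> (\<open>card_subseqs_with_overlap\<close>).

  For \<open>r = 2 * k - 1\<close> the product is \<open>(r choose k)\<^sup>2 * fact (k - 1) * k\<close>, and division by the \<open>fact k\<close>
  possible \<open>\<sigma>'\<close> leaves \<open>(r choose k)\<^sup>2\<close>. The count does not involve the shape of \<open>\<sigma>\<close>.
\<close>

text \<open>
  On words with a fixed set \<open>V\<close> of entries, \<open>red\<close> applies one and the same injection, the rank in
  \<open>V\<close>, to every entry, so it is injective; surjectivity follows because both sides have \<open>fact (card V)\<close>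
  elements.
\<close>

lemma bij_betw_red:
  assumes "finite V"
  shows "bij_betw red (permutations_of_set V) (Sym (card V))"
proof -
  have inj: "inj_on (\<lambda>v. card {w \<in> V. w \<le> v}) V"
  proof (rule inj_onI)
    fix v w assume "v \<in> V" "w \<in> V" "card {u \<in> V. u \<le> v} = card {u \<in> V. u \<le> w}"
    then show "v = w"
      using rank_less_iff[OF assms, of v w] rank_less_iff[OF assms, of w v] by simp
  qed
  have "inj_on red (permutations_of_set V)"
  proof (rule inj_onI)
    fix x y assume "x \<in> permutations_of_set V" "y \<in> permutations_of_set V" "red x = red y"
    then show "x = y"
      using inj by (auto simp: permutations_of_set_def red_def dest: map_inj_on)
  qed
  moreover have "red ` permutations_of_set V \<subseteq> Sym (card V)"
    using red_in_Sym by (auto simp: permutations_of_set_def distinct_card[symmetric])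
  moreover have "card (permutations_of_set V) = card (Sym (card V))"
    using assms by (simp add: Sym_def)
  ultimately show ?thesis
    by (simp add: bij_betw_def card_image card_subset_eq Sym_def)
qed

lemma red_in_Sym_iff:
  assumes "distinct x"
  shows "red x \<in> Sym k \<longleftrightarrow> length x = k"
proof
  assume "red x \<in> Sym k"
  then have "length (red x) = k"
    by (auto simp: Sym_def dest: length_finite_permutations_of_set)
  then show "length x = k" by (simp add: red_def)
qed (use red_in_Sym[OF assms] in auto)

text \<open>
  Each \<open>k\<close>-element subset of \<open>A\<close> can be arranged in exactly one way so as to have the pattern
  \<open>\<sigma>\<close>, by \<open>bij_betw_red\<close>.
\<close>

lemma card_words_with_red:
  assumes "\<sigma> \<in> Sym k" "finite A"
  shows "card {x. distinct x \<and> set x \<subseteq> A \<and> red x = \<sigma>} = card A choose k"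
proof -
  have len: "length x = k" if "distinct x" "red x = \<sigma>" for x
    using that assms(1) red_in_Sym_iff by blast
  have "bij_betw set {x. distinct x \<and> set x \<subseteq> A \<and> red x = \<sigma>} {V. V \<subseteq> A \<and> card V = k}"
    unfolding bij_betw_def
  proof (intro conjI inj_onI equalityI subsetI)
    fix x y
    assume "x \<in> {x. distinct x \<and> set x \<subseteq> A \<and> red x = \<sigma>}"
      "y \<in> {x. distinct x \<and> set x \<subseteq> A \<and> red x = \<sigma>}" "set x = set y"
    then show "x = y"
      using bij_betw_red[of "set x"]
      by (auto simp: bij_betw_def permutations_of_set_def dest: inj_onD)
  next
    fix V assume "V \<in> set ` {x. distinct x \<and> set x \<subseteq> A \<and> red x = \<sigma>}"
    then show "V \<in> {V. V \<subseteq> A \<and> card V = k}"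
      using len by (auto simp: distinct_card)
  next
    fix V assume V: "V \<in> {V. V \<subseteq> A \<and> card V = k}"
    then have "\<sigma> \<in> red ` permutations_of_set V"
      using bij_betw_red[of V] assms finite_subset by (auto simp: bij_betw_def)
    then show "V \<in> set ` {x. distinct x \<and> set x \<subseteq> A \<and> red x = \<sigma>}"
      using V by (auto simp: permutations_of_set_def)
  qed
  then show ?thesis
    using n_subsets[OF assms(2)] by (simp add: bij_betw_same_card)
qed

text \<open>
  A subsequence of a list without repetitions can be recovered from its set of entries. This turns
  statements about subsequences into statements about sets.
\<close>

lemma subseq_distinct_eq_filter:
  assumes "subseq x p" "distinct p"
  shows "filter (\<lambda>v. v \<in> set x) p = x"
  using assms
proof (induction rule: list_emb.induct)
  case (list_emb_Nil ys)
  then show ?case by simp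
next
  case (list_emb_Cons xs ys y)
  then have "y \<notin> set xs" by (auto elim: list_emb_set)
  with list_emb_Cons show ?case by simp
next
  case (list_emb_Cons2 x y xs ys)
  then have "filter (\<lambda>v. v \<in> set (x # xs)) ys = filter (\<lambda>v. v \<in> set xs) ys"
    by (intro filter_cong) auto
  with list_emb_Cons2 show ?case by simp
qed

lemma subseq_distinctD:
  assumes "subseq x p" "distinct p"
  shows "distinct x" and "set x \<subseteq> set p"
  using distinct_filter[OF assms(2), of "\<lambda>v. v \<in> set x"] filter_is_subset[of "\<lambda>v. v \<in> set x" p]
  by (simp_all add: subseq_distinct_eq_filter[OF assms])

text \<open>
  The permutations of \<open>A\<close> that contain \<open>x\<close> split into disjoint classes according to the list
  \<open>z\<close> formed by their entries outside \<open>x\<close>; the class of \<open>z\<close> consists of the shuffles of \<open>x\<close> and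
  \<open>z\<close>, and all classes have the same size.
\<close>

lemma card_permutations_containing_subseq:
  assumes "finite A" "distinct x" "set x \<subseteq> A"
  shows "card {p \<in> permutations_of_set A. subseq x p} =
    (card A choose length x) * fact (card A - length x)"
proof -
  let ?Z = "permutations_of_set (A - set x)"
  have disj: "set x \<inter> set z = {}" if "z \<in> ?Z" for z
    using that by (auto simp: permutations_of_set_def)
  have eq: "{p \<in> permutations_of_set A. subseq x p} = (\<Union>z\<in>?Z. shuffles x z)"
  proof (intro equalityI subsetI)
    fix p assume p: "p \<in> {p \<in> permutations_of_set A. subseq x p}"
    then have "p \<in> shuffles x (filter (\<lambda>v. v \<notin> set x) p)"
      using partition_in_shuffles[of p "\<lambda>v. v \<in> set x"] subseq_distinct_eq_filter[of x p]
      by (simp add: permutations_of_set_def)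
    moreover have "filter (\<lambda>v. v \<notin> set x) p \<in> ?Z"
      using p by (auto simp: permutations_of_set_def)
    ultimately show "p \<in> (\<Union>z\<in>?Z. shuffles x z)" by blast
  next
    fix p assume "p \<in> (\<Union>z\<in>?Z. shuffles x z)"
    then obtain z where z: "z \<in> ?Z" "p \<in> shuffles x z" by blast
    have "filter (\<lambda>v. v \<in> set x) p = x"
      using filter_shuffles_disjoint1(1)[OF disj[OF z(1)] z(2)] .
    then have "subseq x p" by (metis subseq_filter_left)
    moreover have "p \<in> permutations_of_set A"
      using z assms distinct_disjoint_shuffles[OF assms(2) _ disj[OF z(1)] z(2)]
        set_shuffles[OF z(2)]
      by (auto simp: permutations_of_set_def)
    ultimately show "p \<in> {p \<in> permutations_of_set A. subseq x p}" by blast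
  qed
  have "shuffles x z \<inter> shuffles x z' = {}" if "z \<in> ?Z" "z' \<in> ?Z" "z \<noteq> z'" for z z'
    using that filter_shuffles_disjoint1(2)[OF disj[OF that(1)]]
      filter_shuffles_disjoint1(2)[OF disj[OF that(2)]] by blast
  then have "card (\<Union>z\<in>?Z. shuffles x z) = (\<Sum>z\<in>?Z. card (shuffles x z))"
    by (intro card_UN_disjoint) auto
  also have "\<dots> = (\<Sum>z\<in>?Z. card A choose length x)"
  proof (rule sum.cong[OF refl])
    fix z assume z: "z \<in> ?Z"
    have "length z = card A - length x"
      using z assms by (simp add: length_finite_permutations_of_set card_Diff_subset distinct_card)
    moreover have "length x \<le> card A"
      using assms card_mono[of A "set x"] by (simp add: distinct_card)
    ultimately show "card (shuffles x z) = card A choose length x"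
      using card_disjoint_shuffles[OF disj[OF z]] by simp
  qed
  also have "\<dots> = (card A choose length x) * fact (card A - length x)"
    using assms by (simp add: card_Diff_subset distinct_card)
  finally show ?thesis by (simp add: eq)
qed

text \<open>
  Outside \<open>x\<close> there are \<open>r - k\<close> entries of \<open>p\<close>, and \<open>y\<close> takes exactly \<open>k - (2 * k - r) = r - k\<close> of
  its entries from there. Hence \<open>y\<close> takes all of them, and only the shared entries can be chosen.
\<close>

lemma card_subseqs_with_overlap:
  assumes "distinct p" "subseq x p" "length x = k" "length p = r" "k \<le> r" "r \<le> 2 * k"
  shows "card {y. subseq y p \<and> length y = k \<and> card (set x \<inter> set y) = 2 * k - r} =
    k choose (2 * k - r)"
proof -
  let ?Y = "{y. subseq y p \<and> length y = k \<and> card (set x \<inter> set y) = 2 * k - r}"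
  let ?S = "{S. S \<subseteq> set x \<and> card S = 2 * k - r}"
  let ?f = "\<lambda>S. filter (\<lambda>v. v \<in> S \<or> v \<notin> set x) p"
  have x: "distinct x" "set x \<subseteq> set p"
    using subseq_distinctD[OF assms(2,1)] .
  have cx: "card (set p - set x) = r - k"
    using assms x by (simp add: card_Diff_subset distinct_card)
  have complement: "set p - set x \<subseteq> set y" if y: "y \<in> ?Y" for y
  proof -
    have yp: "distinct y" "set y \<subseteq> set p"
      using subseq_distinctD[of y p] y assms(1) by simp_all
    have "card (set y) = card (set x \<inter> set y) + card (set y - set x)"
      using card_Int_Diff[of "set y" "set x"] by (simp add: Int_commute)
    then have "card (set y - set x) = r - k"
      using y distinct_card[OF yp(1)] assms(5,6) by auto
    moreover have "set y - set x \<subseteq> set p - set x" using yp by auto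
    ultimately have "set y - set x = set p - set x"
      using cx by (intro card_subset_eq) auto
    then show ?thesis by auto
  qed
  have "bij_betw (\<lambda>y. set x \<inter> set y) ?Y ?S"
  proof (rule bij_betw_byWitness[where f' = ?f])
    show "\<forall>y\<in>?Y. ?f (set x \<inter> set y) = y"
    proof
      fix y assume y: "y \<in> ?Y"
      have "?f (set x \<inter> set y) = filter (\<lambda>v. v \<in> set y) p"
        using complement[OF y] by (intro filter_cong) auto
      then show "?f (set x \<inter> set y) = y"
        using subseq_distinct_eq_filter[of y p] y assms by simp
    qed
    show inv: "\<forall>S\<in>?S. set x \<inter> set (?f S) = S" using x by auto
    show "(\<lambda>y. set x \<inter> set y) ` ?Y \<subseteq> ?S" by auto
    show "?f ` ?S \<subseteq> ?Y"
    proof (rule image_subsetI)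
      fix S assume S: "S \<in> ?S"
      have "set (?f S) = S \<union> (set p - set x)" using S x by auto
      moreover have "card (S \<union> (set p - set x)) = (2 * k - r) + (r - k)"
        using S cx by (subst card_Un_disjoint) (auto intro: finite_subset)
      ultimately have "card (set (?f S)) = k" using assms by simp
      then have "length (?f S) = k"
        using distinct_card[OF distinct_filter[OF assms(1)]] by simp
      then show "?f S \<in> ?Y" using S inv by simp
    qed
  qed
  then have "card ?Y = card ?S" by (rule bij_betw_same_card)
  then show ?thesis using x assms by (simp add: n_subsets distinct_card)
qed

text \<open>
  Once all \<open>\<sigma>'\<close> are summed over, the second pattern only requires \<open>y\<close> to have length \<open>k\<close>. The
  triples are reordered as \<open>(x, p, y)\<close> because the choices made in this order form a dependent product in which every
  fibre has constant size; starting with \<open>p\<close> would not do, since the number of occurrences of \<open>\<sigma>\<close>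
  varies with \<open>p\<close>.
\<close>

lemma sum_a_pair:
  assumes "\<sigma> \<in> Sym k" "k \<le> r" "r \<le> 2 * k"
  shows "(\<Sum>\<sigma>'\<in>Sym k. a_pair k \<sigma> \<sigma>' r) = (r choose k)\<^sup>2 * fact (r - k) * (k choose (2 * k - r))"
proof -
  let ?X = "{x. distinct x \<and> set x \<subseteq> {1..r} \<and> red x = \<sigma>}"
  let ?P = "\<lambda>x. {p \<in> permutations_of_set {1..r}. subseq x p}"
  let ?Y = "\<lambda>x p. {y. subseq y p \<and> length y = k \<and> card (set x \<inter> set y) = 2 * k - r}"
  let ?T = "SIGMA x:?X. SIGMA p:?P x. ?Y x p"
  have sub: "distinct x \<and> set x \<subseteq> {1..r}" if "subseq x p" "p \<in> Sym r" for x p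
  proof -
    have p: "distinct p" "set p = {1..r}"
      using that(2) by (auto simp: Sym_def permutations_of_set_def)
    with subseq_distinctD[OF that(1) p(1)] show ?thesis by simp
  qed
  have finY: "finite (?Y x p)" for x p
    by (rule finite_subset[of _ "set (subseqs p)"]) auto
  have finX: "finite ?X"
    by (rule finite_subset[OF _ finite_subset_distinct[of "{1..r}"]]) auto
  have finT: "finite ?T" using finX finY by (intro finite_SigmaI) auto
  have eq: "(\<Union>\<sigma>'\<in>Sym k. A_set k \<sigma> \<sigma>' r) = (\<lambda>(x, p, y). (p, x, y)) ` ?T"
  proof (intro equalityI subsetI)
    fix t assume "t \<in> (\<Union>\<sigma>'\<in>Sym k. A_set k \<sigma> \<sigma>' r)"
    then obtain p x y where t: "t = (p, x, y)" and *: "p \<in> Sym r" "subseq x p" "subseq y p"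
      "red x = \<sigma>" "red y \<in> Sym k" "int (card (set x \<inter> set y)) = 2 * int k - int r"
      by (auto simp: A_set_def subs_def)
    from * sub[of x p] sub[of y p] red_in_Sym_iff[of y k] assms have "(x, p, y) \<in> ?T"
      by (auto simp: Sym_def)
    then show "t \<in> (\<lambda>(x, p, y). (p, x, y)) ` ?T" unfolding t by force
  next
    fix t assume "t \<in> (\<lambda>(x, p, y). (p, x, y)) ` ?T"
    then obtain p x y where t: "t = (p, x, y)" and *: "p \<in> Sym r" "subseq x p" "subseq y p"
      "red x = \<sigma>" "length y = k" "card (set x \<inter> set y) = 2 * k - r"
      by (auto simp: Sym_def)
    from * sub[of y p] red_in_Sym_iff[of y k] assms
    show "t \<in> (\<Union>\<sigma>'\<in>Sym k. A_set k \<sigma> \<sigma>' r)"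
      by (auto simp: t A_set_def subs_def)
  qed
  have inj: "inj_on (\<lambda>(x, p, y). (p, x, y)) ?T" by (auto simp: inj_on_def)
  have finU: "finite (\<Union>\<sigma>'\<in>Sym k. A_set k \<sigma> \<sigma>' r)" unfolding eq using finT by (rule finite_imageI)
  have "(\<Sum>\<sigma>'\<in>Sym k. a_pair k \<sigma> \<sigma>' r) = card (\<Union>\<sigma>'\<in>Sym k. A_set k \<sigma> \<sigma>' r)"
    unfolding a_pair_def
    by (rule card_UN_disjoint[symmetric])
      (auto simp: Sym_def A_set_def intro: finite_subset[OF _ finU[unfolded Sym_def A_set_def]])
  also have "\<dots> = card ?T" unfolding eq using inj by (rule card_image)
  also have "\<dots> = (\<Sum>x\<in>?X. \<Sum>p\<in>?P x. card (?Y x p))"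
  proof -
    have "card ?T = (\<Sum>x\<in>?X. card (SIGMA p:?P x. ?Y x p))"
      using finX finY by (intro card_SigmaI ballI finite_SigmaI) auto
    moreover have "card (SIGMA p:?P x. ?Y x p) = (\<Sum>p\<in>?P x. card (?Y x p))" for x
      using finY by (intro card_SigmaI ballI) auto
    ultimately show ?thesis by simp
  qed
  also have "\<dots> = (\<Sum>x\<in>?X. \<Sum>p\<in>?P x. k choose (2 * k - r))"
  proof (intro sum.cong refl card_subseqs_with_overlap)
    fix x p assume x: "x \<in> ?X" and p: "p \<in> ?P x"
    show "length x = k" using x red_in_Sym_iff[of x k] assms by simp
    show "distinct p" "length p = r"  "subseq x p"
      using p by (auto simp: permutations_of_set_def dest: distinct_card)
  qed (use assms in auto)
  also have "\<dots> = (\<Sum>x\<in>?X. (r choose k) * fact (r - k) * (k choose (2 * k - r)))"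
  proof (rule sum.cong[OF refl])
    fix x assume x: "x \<in> ?X"
    moreover have "length x = k" using x red_in_Sym_iff[of x k] assms by simp
    ultimately show "(\<Sum>p\<in>?P x. k choose (2 * k - r)) =
        (r choose k) * fact (r - k) * (k choose (2 * k - r))"
      using card_permutations_containing_subseq[of "{1..r}" x] by simp
  qed
  also have "\<dots> = (r choose k)\<^sup>2 * fact (r - k) * (k choose (2 * k - r))"
    using card_words_with_red[OF assms(1), of "{1..r}"] by (simp add: power2_eq_square)
  finally show ?thesis .
qed

theorem theorem6p4:
  fixes k :: nat and \<sigma> :: "nat list"
  assumes "k \<ge> 1" and "\<sigma> \<in> Sym k"
  shows "a_self k \<sigma> (2 * k - 1) > ((2 * k - 1) choose k)\<^sup>2 \<longleftrightarrow>
    real (a_self k \<sigma> (2 * k - 1)) >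
      measure_pmf.expectation (pmf_of_set (Sym k)) (\<lambda>\<sigma>'. real (a_pair k \<sigma> \<sigma>' (2 * k - 1)))"
proof -
  have fin: "finite (Sym k)" and card: "card (Sym k) = fact k" by (simp_all add: Sym_def)
  have k: "2 * k - 1 - k = k - 1" "2 * k - (2 * k - 1) = 1" using assms(1) by auto
  have "fact (k - 1) * k = (fact k :: nat)"
    using assms(1) by (simp add: fact_reduce mult.commute)
  then have sum: "(\<Sum>\<sigma>'\<in>Sym k. a_pair k \<sigma> \<sigma>' (2 * k - 1)) = ((2 * k - 1) choose k)\<^sup>2 * fact k"
    using sum_a_pair[OF assms(2), of "2 * k - 1"] assms(1) by (simp add: k mult.assoc)
  have "measure_pmf.expectation (pmf_of_set (Sym k)) (\<lambda>\<sigma>'. real (a_pair k \<sigma> \<sigma>' (2 * k - 1))) =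
      (\<Sum>\<sigma>'\<in>Sym k. real (a_pair k \<sigma> \<sigma>' (2 * k - 1))) / real (card (Sym k))"
    using fin assms(2) by (intro integral_pmf_of_set) auto
  also have "\<dots> = real (((2 * k - 1) choose k)\<^sup>2)"
    unfolding of_nat_sum[symmetric] sum card by simp
  finally show ?thesis by (simp only: of_nat_less_iff)
qed

end
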